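(* Let $\mathbb{K}=\mathbb{R}_+^{n_1}\times\prod_{h=2}^N\operatorname{svec}(\mathbb{S}_+^{n_h})\subseteq\mathbb{R}^n$, $n=n_1+\sum_{h=2}^N n_h(n_h+1)/2$, be a direct product of a nonnegative orthant and (vectorized) positive semidefinite cones. Then $\mathcal{DNN}_{\rm NN}(\mathbb{K})\subseteq\mathcal{DNN}_{\rm ZVP}(\mathbb{K})$. Moreover, the inclusion is strict if $n_1\ge 1$ and $n_2\ge 2$ (so in particular $N\ge 2$).
   Context: $\mathbb{N}$ is the set of nonnegative integers; $\mathbb{S}^m$ is the space of real symmetric $m\times m$ matrices with inner product $\langle X,Y\rangle=\sum_{i,j}X_{i,j}Y_{i,j}$; $\mathbb{S}_+^m$ is the cone of positive semidefinite matrices in $\mathbb{S}^m$; $\mathbb{R}_+^m$ is the nonnegative orthant; $T_m=m(m+1)/2$. For a cone $\mathcal{K}\subseteq\mathbb{S}^n$, $\mathcal{K}^*=\{X\in\mathbb{S}^n\mid\langle X,Y\rangle\ge0\ \forall Y\in\mathcal{K}\}$. $H^{n,m}$ is the set of real homogeneous polynomials in $n$ variables of degree $m$ (with $H^{n,0}$ the constants), and $\Sigma^{n,4}=\operatorname{conv}\{\theta^2\mid\theta\in H^{n,2}\}$. The linear isometry $\operatorname{svec}:\mathbb{S}^m\to\mathbb{R}^{T_m}$ is $\operatorname{svec}(X)=(X_{1,1},\sqrt2X_{1,2},X_{2,2},\dots,\sqrt2X_{1,m},\dots,\sqrt2X_{m-1,m},X_{m,m})$, and $\operatorname{smat}$ is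 its inverse. Indexing: $N\ge1$, $n_1\ge0$, $n_h\ge1$ for $h=2,\dots,N$, $n\ge1$. Coordinates of $x\in\mathbb{R}^n$ are reindexed by $1i:=i$ ($1\le i\le n_1$) and $hij:=n_1+\sum_{k=2}^{h-1}T_{n_k}+j(j-1)/2+i$ ($2\le h\le N$, $1\le i\le j\le n_h$). Write $x=(x^{(1)},x^{(2)},\dots,x^{(N)})$ with $x^{(1)}\in\mathbb{R}^{n_1}$, $x^{(h)}\in\mathbb{R}^{T_{n_h}}$. Let $\widetilde{\mathcal{I}}_{\ge0}=\{1i\mid1\le i\le n_1\}\cup\{hii\mid2\le h\le N,\ 1\le i\le n_h\}$. ZVP-type cone: $\mathbb{K}$ is described as the set of $x\in\mathbb{R}^n$ at which the following homogeneous polynomials $\phi_1,\dots,\phi_q$ (of degrees $m_1,\dots,m_q$) are all nonnegative: $x_{1i}$ ($1\le i\le n_1$); the principal minors $\det\big(\operatorname{smat}(x^{(h)})_{\mathcal{I},\mathcal{I}}\big)$ for $h=2,\dots,N$ and nonempty $\mathcal{I}\subseteq\{1,\dots,n_h\}$; and $\sum_{I\in\widetilde{\mathcal{I}}_{\ge0}}x_I$. Let $E^{n,2}(\mathbb{K})$ be the convex hull of the set of all polynomials $\psi^2\prod_{j=1}^k\phi_{i_j}$ with $k\in\mathbb{N}$, $i_j\in\{1,\dots,q\}$, $2-\sum_{j=1}^km_{i_j}$ a nonnegative even integer, and $\psi\in H^{n,(2-\sum_jm_{i_j})/2}$. Let $\mathcal{K}_{{\rm ZVP},0}(\mathbb{K})=\{A\in\mathbb{S}^n\mid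 x^\top Ax\in E^{n,2}(\mathbb{K})\}$ and $\mathcal{DNN}_{\rm ZVP}(\mathbb{K})=\mathcal{K}_{{\rm ZVP},0}(\mathbb{K})^*$. NN-type cone: for $x\in\mathbb{R}^n$, let $x\circ x\in\mathbb{R}^n$ be the vector whose first block is $(x_{11}^2,\dots,x_{1n_1}^2)$ and whose $h$th block is $\operatorname{svec}(\operatorname{smat}(x^{(h)})^2)$, $h=2,\dots,N$. Let $\mathcal{K}_{{\rm NN},0}(\mathbb{K})=\{A\in\mathbb{S}^n\mid(x\circ x)^\top A(x\circ x)\in\Sigma^{n,4}\}$ and $\mathcal{DNN}_{\rm NN}(\mathbb{K})=\mathcal{K}_{{\rm NN},0}(\mathbb{K})^*$. *)

theory Defs
  imports
    "HOL-Analysis.Convex"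
    "HOL-Library.Poly_Mapping"
    "Jordan_Normal_Form.Determinant"
    "Jordan_Normal_Form.DL_Submatrix"
begin

section \<open>Real polynomials as a real vector space\<close>

instantiation poly_mapping :: (type, real_vector) real_vector
begin

lift_definition scaleR_poly_mapping :: "real \<Rightarrow> ('a \<Rightarrow>\<^sub>0 'b) \<Rightarrow> ('a \<Rightarrow>\<^sub>0 'b)"
  is "\<lambda>c f k. c *\<^sub>R f k"
  by (rule finite_subset[rotated]) auto

instance
  by standard (transfer; simp add: fun_eq_iff scaleR_add_right scaleR_add_left)+

end

text \<open>
  A monomial is its exponent function \<^typ>\<open>nat \<Rightarrow>\<^sub>0 nat\<close>; the variables are numbered from 0.
\<close>

type_synonym rpoly = "(nat \<Rightarrow>\<^sub>0 nat) \<Rightarrow>\<^sub>0 real"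

definition Var :: "nat \<Rightarrow> rpoly" where
  "Var i = Poly_Mapping.single (Poly_Mapping.single i 1) 1"

definition Const :: "real \<Rightarrow> rpoly" where
  "Const c = Poly_Mapping.single 0 c"

definition hom_polys :: "nat \<Rightarrow> nat \<Rightarrow> rpoly set" where
  "hom_polys n m = {p. \<forall>t \<in> Poly_Mapping.keys p.
     Poly_Mapping.keys t \<subseteq> {..<n} \<and> (\<Sum>i \<in> Poly_Mapping.keys t. Poly_Mapping.lookup t i) = m}"

definition var_vec :: "nat \<Rightarrow> rpoly vec" where
  "var_vec n = vec n Var"

definition quad_form :: "real mat \<Rightarrow> rpoly vec \<Rightarrow> rpoly" where
  "quad_form A v = v \<bullet> (map_mat Const A *\<^sub>v v)"

definition sos4 :: "nat \<Rightarrow> rpoly set" where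
  "sos4 n = convex hull {\<theta>\<^sup>2 | \<theta>. \<theta> \<in> hom_polys n 2}"


section \<open>Symmetric matrices, vectorization\<close>

definition sym_mats :: "nat \<Rightarrow> real mat set" where
  "sym_mats n = {A \<in> carrier_mat n n. transpose_mat A = A}"

definition mat_inner :: "real mat \<Rightarrow> real mat \<Rightarrow> real" where
  "mat_inner X Y = (\<Sum>i<dim_row X. \<Sum>j<dim_col X. X $$ (i,j) * Y $$ (i,j))"

definition dual_cone :: "nat \<Rightarrow> real mat set \<Rightarrow> real mat set" where
  "dual_cone n C = {X \<in> sym_mats n. \<forall>Y \<in> C. 0 \<le> mat_inner X Y}"

definition psd_mats :: "nat \<Rightarrow> real mat set" where
  "psd_mats m = {A \<in> sym_mats m. \<forall>v \<in> carrier_vec m. 0 \<le> v \<bullet> (A *\<^sub>v v)}"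

definition tri :: "nat \<Rightarrow> nat" where
  "tri m = m * (m + 1) div 2"

text \<open>
  \<open>svec\<close> lists the upper triangle column by column.  It and \<open>smat\<close> are polymorphic so that they
  apply both to real matrices and to matrices of polynomials.  With indices from 0, the entry
  \<open>(i, j)\<close>, \<open>i \<le> j\<close>, sits at position \<open>tri j + i\<close>.
\<close>

definition svec :: "'a::real_vector mat \<Rightarrow> 'a vec" where
  "svec X = vec_of_list (concat (map (\<lambda>j. map (\<lambda>i.
     if i = j then X $$ (i,j) else sqrt 2 *\<^sub>R X $$ (i,j)) [0..<Suc j]) [0..<dim_row X]))"

definition smat :: "nat \<Rightarrow> 'a::real_vector vec \<Rightarrow> 'a mat" where
  "smat m v = mat m m (\<lambda>(i,j).
     let e = v $ (tri (max i j) + min i j) in if i = j then e else (1 / sqrt 2) *\<^sub>R e)"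

lemma tri_Suc [simp]: "tri (Suc m) = tri m + Suc m"
  by (simp add: tri_def)

lemma tri_0 [simp]: "tri 0 = 0"
  by (simp add: tri_def)

lemma tri_mono: "m \<le> m' \<Longrightarrow> tri m \<le> tri m'"
  unfolding tri_def by (intro div_le_mono mult_le_mono) auto

lemma tri_index_less:
  assumes "i \<le> j" "j < m" shows "tri j + i < tri m"
proof -
  have "tri j + i < tri (Suc j)" using assms by simp
  also have "\<dots> \<le> tri m" using assms by (intro tri_mono) simp
  finally show ?thesis .
qed

lemma length_concat_triangle:
  "length (concat (map (\<lambda>j. map (f j) [0..<Suc j]) [0..<m])) = tri m"
  by (induction m) (simp_all del: upt_Suc add: upt_Suc_append)

lemma nth_concat_triangle:
  assumes "i \<le> j" "j < m"
  shows "concat (map (\<lambda>j. map (f j) [0..<Suc j]) [0..<m]) ! (tri j + i) = f j i"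
  using assms
proof (induction m)
  case (Suc m)
  let ?g = "\<lambda>m. concat (map (\<lambda>j. map (f j) [0..<Suc j]) [0..<m])"
  have eq: "?g (Suc m) = ?g m @ map (f m) [0..<Suc m]"
    by (simp del: upt_Suc add: upt_Suc_append[of 0 m])
  show ?case
  proof (cases "j = m")
    case True
    then show ?thesis
      using Suc.prems nth_append_length_plus[of "?g m" "map (f m) [0..<Suc m]" i]
      by (simp only: eq length_concat_triangle) (simp del: upt_Suc)
  next
    case False
    then have "tri j + i < length (?g m)"
      using Suc.prems tri_index_less[of i j m] by (simp only: length_concat_triangle)
    then show ?thesis
      using Suc False by (simp only: eq nth_append if_True)
  qed
qed simp

lemma dim_svec [simp]: "dim_vec (svec X) = tri (dim_row X)"
  unfolding svec_def dim_vec_of_list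
  by (rule length_concat_triangle
      [of "\<lambda>j i. if i = j then X $$ (i,j) else sqrt 2 *\<^sub>R X $$ (i,j)"])

lemma svec_index:
  assumes "i \<le> j" "j < dim_row X"
  shows "svec X $ (tri j + i) = (if i = j then X $$ (i,j) else sqrt 2 *\<^sub>R X $$ (i,j))"
  unfolding svec_def vec_of_list_index
  by (rule nth_concat_triangle
      [OF assms, of "\<lambda>j i. if i = j then X $$ (i,j) else sqrt 2 *\<^sub>R X $$ (i,j)"])

lemma smat_svec:
  assumes X: "X \<in> carrier_mat m m" and sym: "transpose_mat X = X"
  shows "smat m (svec X) = X"
proof (rule eq_matI)
  fix i j assume ij: "i < dim_row X" "j < dim_col X"
  then have lt: "i < m" "j < m" using X by auto
  have "X $$ (i,j) = X $$ (j,i)"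
    using sym ij X by (metis carrier_matD index_transpose_mat(1))
  then have "X $$ (min i j, max i j) = X $$ (i,j)" by (auto simp: min_def max_def)
  then show "smat m (svec X) $$ (i,j) = X $$ (i,j)"
    using lt X svec_index[of "min i j" "max i j" X]
    by (auto simp: smat_def Let_def)
qed (use X in \<open>auto simp: smat_def\<close>)

lemma tri_index_ex:
  assumes "k < tri m" obtains i j where "i \<le> j" "j < m" "k = tri j + i"
  using assms
proof (induction m arbitrary: thesis)
  case (Suc m)
  show ?case
  proof (cases "k < tri m")
    case True
    then show ?thesis using Suc by (metis less_Suc_eq)
  next
    case False
    then show ?thesis using Suc.prems(1)[of "k - tri m" m] Suc.prems(2) by auto
  qed
qed simp

lemma svec_smat:
  assumes "v \<in> carrier_vec (tri m)"
  shows "svec (smat m v) = v"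
proof (rule eq_vecI)
  fix k assume "k < dim_vec v"
  then have "k < tri m" using assms by auto
  then obtain i j where ij: "i \<le> j" "j < m" "k = tri j + i" by (rule tri_index_ex)
  then show "svec (smat m v) $ k = v $ k"
    using svec_index[of i j "smat m v"] by (auto simp: smat_def Let_def)
qed (use assms in \<open>simp add: smat_def\<close>)


section \<open>The block structure of the cone\<close>

text \<open>
  The cone is given by \<open>N\<close> and \<open>d\<close> with \<open>d h = n\<^sub>h\<close>, \<open>1 \<le> h \<le> N\<close>.
  Both relaxations below depend on this data (through the describing polynomials and the
  product \<open>x \<circ> x\<close>, respectively), which the set \<open>sym_cone N d\<close> alone does not determine:
  a block with \<open>n\<^sub>h = 1\<close> is a half-line.
\<close>

definition blk_dim :: "(nat \<Rightarrow> nat) \<Rightarrow> nat \<Rightarrow> nat" where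
  "blk_dim d h = (if h = 1 then d 1 else tri (d h))"

definition blk_off :: "(nat \<Rightarrow> nat) \<Rightarrow> nat \<Rightarrow> nat" where
  "blk_off d h = (\<Sum>k = 1..<h. blk_dim d k)"

definition total_dim :: "nat \<Rightarrow> (nat \<Rightarrow> nat) \<Rightarrow> nat" where
  "total_dim N d = (\<Sum>h = 1..N. blk_dim d h)"

definition blk :: "(nat \<Rightarrow> nat) \<Rightarrow> nat \<Rightarrow> 'a vec \<Rightarrow> 'a vec" where
  "blk d h x = vec (blk_dim d h) (\<lambda>k. x $ (blk_off d h + k))"

definition sym_cone :: "nat \<Rightarrow> (nat \<Rightarrow> nat) \<Rightarrow> real vec set" where
  "sym_cone N d = {x \<in> carrier_vec (total_dim N d).
     (\<forall>i < d 1. 0 \<le> blk d 1 x $ i) \<and> (\<forall>h \<in> {2..N}. blk d h x \<in> svec ` psd_mats (d h))}"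

definition nonneg_idx :: "nat \<Rightarrow> (nat \<Rightarrow> nat) \<Rightarrow> nat set" where
  "nonneg_idx N d = {..<d 1} \<union> {blk_off d h + tri i + i | h i. h \<in> {2..N} \<and> i < d h}"


section \<open>The ZVP-type cone\<close>

text \<open>
  The describing polynomials \<open>\<phi>\<close> of \<open>sym_cone N d\<close>, each paired with its degree.
\<close>

definition cone_polys :: "nat \<Rightarrow> (nat \<Rightarrow> nat) \<Rightarrow> (rpoly \<times> nat) set" where
  "cone_polys N d =
     {(Var i, 1) | i. i < d 1}
   \<union> {(det (submatrix (smat (d h) (blk d h (var_vec (total_dim N d)))) I I), card I) | h I.
        h \<in> {2..N} \<and> I \<subseteq> {..<d h} \<and> I \<noteq> {}}
   \<union> {(\<Sum>i \<in> nonneg_idx N d. Var i, 1)}"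

definition E2 :: "nat \<Rightarrow> (rpoly \<times> nat) set \<Rightarrow> rpoly set" where
  "E2 n \<Phi> = convex hull {\<psi>\<^sup>2 * prod_list (map fst gs) | \<psi> gs.
     set gs \<subseteq> \<Phi> \<and> sum_list (map snd gs) \<le> 2 \<and> even (2 - sum_list (map snd gs)) \<and>
     \<psi> \<in> hom_polys n ((2 - sum_list (map snd gs)) div 2)}"

definition K_ZVP0 :: "nat \<Rightarrow> (nat \<Rightarrow> nat) \<Rightarrow> real mat set" where
  "K_ZVP0 N d = (let n = total_dim N d in
     {A \<in> sym_mats n. quad_form A (var_vec n) \<in> E2 n (cone_polys N d)})"

definition DNN_ZVP :: "nat \<Rightarrow> (nat \<Rightarrow> nat) \<Rightarrow> real mat set" where
  "DNN_ZVP N d = dual_cone (total_dim N d) (K_ZVP0 N d)"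


section \<open>The NN-type cone\<close>

definition blk_square :: "(nat \<Rightarrow> nat) \<Rightarrow> nat \<Rightarrow> rpoly vec \<Rightarrow> rpoly vec" where
  "blk_square d h x =
     (if h = 1 then map_vec (\<lambda>p. p\<^sup>2) (blk d 1 x)
      else svec (smat (d h) (blk d h x) * smat (d h) (blk d h x)))"

definition jordan_square :: "nat \<Rightarrow> (nat \<Rightarrow> nat) \<Rightarrow> rpoly vec \<Rightarrow> rpoly vec" where
  "jordan_square N d x =
     vec_of_list (concat (map (\<lambda>h. list_of_vec (blk_square d h x)) [1..<Suc N]))"

definition K_NN0 :: "nat \<Rightarrow> (nat \<Rightarrow> nat) \<Rightarrow> real mat set" where
  "K_NN0 N d = (let n = total_dim N d in
     {A \<in> sym_mats n. quad_form A (jordan_square N d (var_vec n)) \<in> sos4 n})"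

definition DNN_NN :: "nat \<Rightarrow> (nat \<Rightarrow> nat) \<Rightarrow> real mat set" where
  "DNN_NN N d = dual_cone (total_dim N d) (K_NN0 N d)"

end

theory Submission
  imports Defs
begin

text \<open>
  Substituting \<open>x \<circ> x\<close> for \<open>x\<close> is a ring homomorphism that turns every generator of the ZVP-type
  cone into a sum of squares: a linear form becomes a quadratic one, the coordinates indexed by
  \<open>nonneg_idx\<close> become sums of squares of linear forms, and the \<open>2 \<times> 2\<close> principal minors of a block
  \<open>X\<^sup>2\<close> are sums of squares by Lagrange's identity (larger minors have degree above 2).
  Hence \<open>K_ZVP0 \<subseteq> K_NN0\<close>, and dualizing reverses the inclusion.

  For strictness let \<open>a\<close> be the first orthant coordinate and \<open>X\<close> the block with \<open>h = 2\<close>.  The form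
  \<open>a (X\<^sub>1\<^sub>1 + X\<^sub>2\<^sub>2 - 2 X\<^sub>1\<^sub>2)\<close> becomes \<open>a\<^sup>2\<close> times a sum of squares.  It is separated from \<open>K_ZVP0\<close> by
  \<open>u u\<^sup>T + w w\<^sup>T\<close>, where \<open>u\<close> has \<open>a = X\<^sub>1\<^sub>2 = 1\<close>, \<open>w\<close> has \<open>X\<^sub>1\<^sub>1 = X\<^sub>2\<^sub>2 = 1\<close> and all other entries vanish:
  only the minor \<open>X\<^sub>1\<^sub>1 X\<^sub>2\<^sub>2 - X\<^sub>1\<^sub>2\<^sup>2\<close> is negative at \<open>u\<close>, and its value at \<open>w\<close> compensates for it.
\<close>

section \<open>Substitution into polynomials\<close>

lemma lookup_scaleR [simp]: "Poly_Mapping.lookup (c *\<^sub>R p) t = c *\<^sub>R Poly_Mapping.lookup p t"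
  by transfer simp

lemma keys_scaleR: "Poly_Mapping.keys (c *\<^sub>R p) \<subseteq> Poly_Mapping.keys p"
  by (auto simp: in_keys_iff)

lemma scaleR_single: "c *\<^sub>R Poly_Mapping.single k b = Poly_Mapping.single k (c *\<^sub>R b)"
  by (rule poly_mapping_eqI) (auto simp: lookup_single when_def)

lemma poly_mapping_expand:
  "p = (\<Sum>t\<in>Poly_Mapping.keys p. Poly_Mapping.single t (Poly_Mapping.lookup p t))"
  by (rule poly_mapping_eqI) (auto simp: lookup_sum lookup_single when_def in_keys_iff)

text \<open>Both laws are bilinear, so expanding each factor into single terms reduces them to the
  coefficients. The instance lets polynomials themselves be the values substituted by
  \<open>poly_subst\<close>.\<close>

instance poly_mapping :: (monoid_add, real_algebra) real_algebra
proof
  fix a :: real and x y :: "'a \<Rightarrow>\<^sub>0 'b"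
  obtain S c where x: "x = (\<Sum>k\<in>S. Poly_Mapping.single k (c k))"
    using poly_mapping_expand by blast
  obtain T e where y: "y = (\<Sum>k\<in>T. Poly_Mapping.single k (e k))"
    using poly_mapping_expand by blast
  show "a *\<^sub>R x * y = a *\<^sub>R (x * y)" "x * a *\<^sub>R y = a *\<^sub>R (x * y)"
    by (simp_all add: x y scaleR_sum_right sum_product scaleR_single mult_single)
qed

instance poly_mapping :: (monoid_add, real_algebra_1) real_algebra_1 ..

definition monom_subst :: "(nat \<Rightarrow> 'a::comm_ring_1) \<Rightarrow> (nat \<Rightarrow>\<^sub>0 nat) \<Rightarrow> 'a" where
  "monom_subst f t = (\<Prod>i\<in>Poly_Mapping.keys t. f i ^ Poly_Mapping.lookup t i)"

text \<open>The target algebra is left open: polynomials give the substitution of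
  \<open>jordan_square\<close>, real numbers give evaluation at the two separating points.\<close>

definition poly_subst :: "(nat \<Rightarrow> 'a::{comm_ring_1,real_algebra_1}) \<Rightarrow> rpoly \<Rightarrow> 'a" where
  "poly_subst f p = (\<Sum>t\<in>Poly_Mapping.keys p. Poly_Mapping.lookup p t *\<^sub>R monom_subst f t)"

lemma monom_subst_superset:
  assumes "finite S" "Poly_Mapping.keys t \<subseteq> S"
  shows "monom_subst f t = (\<Prod>i\<in>S. f i ^ Poly_Mapping.lookup t i)"
  unfolding monom_subst_def
  by (rule prod.mono_neutral_left) (use assms in \<open>auto simp: in_keys_iff\<close>)

lemma monom_subst_add: "monom_subst f (s + t) = monom_subst f s * monom_subst f t"
proof -
  let ?S = "Poly_Mapping.keys s \<union> Poly_Mapping.keys t"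
  have "Poly_Mapping.keys (s + t) \<subseteq> ?S" by (rule keys_add)
  then show ?thesis
    by (simp add: monom_subst_superset[of ?S] lookup_add power_add prod.distrib)
qed

lemma poly_subst_superset:
  assumes "finite S" "Poly_Mapping.keys p \<subseteq> S"
  shows "poly_subst f p = (\<Sum>t\<in>S. Poly_Mapping.lookup p t *\<^sub>R monom_subst f t)"
  unfolding poly_subst_def
  by (rule sum.mono_neutral_left) (use assms in \<open>auto simp: in_keys_iff\<close>)

lemma linear_poly_subst: "linear (poly_subst f)"
proof (rule linearI)
  fix p q :: rpoly and c :: real
  let ?S = "Poly_Mapping.keys p \<union> Poly_Mapping.keys q"
  have "Poly_Mapping.keys (p + q) \<subseteq> ?S" by (rule keys_add)
  then show "poly_subst f (p + q) = poly_subst f p + poly_subst f q"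
    by (simp add: poly_subst_superset[of ?S] lookup_add scaleR_add_left sum.distrib)
  show "poly_subst f (c *\<^sub>R p) = c *\<^sub>R poly_subst f p"
    by (simp add: poly_subst_superset[of "Poly_Mapping.keys p"] keys_scaleR scaleR_sum_right)
qed

lemmas poly_subst_add = linear_add[OF linear_poly_subst]
  and poly_subst_diff = linear_diff[OF linear_poly_subst]
  and poly_subst_scaleR = linear_cmul[OF linear_poly_subst]
  and poly_subst_sum = linear_sum[OF linear_poly_subst]

lemma poly_subst_single: "poly_subst f (Poly_Mapping.single t c) = c *\<^sub>R monom_subst f t"
  by (simp add: poly_subst_superset[of "{t}"])

text \<open>Monomials are handled by \<open>monom_subst_add\<close>; expanding both factors into
  single terms extends this bilinearly.\<close>

lemma poly_subst_mult: "poly_subst f (p * q) = poly_subst f p * poly_subst f q"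
  by (subst poly_mapping_expand[of p], subst poly_mapping_expand[of q])
    (simp add: sum_product poly_subst_sum mult_single poly_subst_single monom_subst_add
      poly_subst_def[of f p] poly_subst_def[of f q] mult.commute)

lemma poly_subst_power2: "poly_subst f (p\<^sup>2) = (poly_subst f p)\<^sup>2"
  by (simp add: power2_eq_square poly_subst_mult)

lemma poly_subst_Var [simp]: "poly_subst f (Var i) = f i"
  by (simp add: Var_def poly_subst_single monom_subst_def)

lemmas poly_subst_simps = poly_subst_add poly_subst_diff poly_subst_scaleR poly_subst_sum
  poly_subst_mult poly_subst_power2

lemma Const_mult: "Const c * p = c *\<^sub>R p"
proof -
  have "Const c = c *\<^sub>R 1"
    unfolding Const_def single_one[symmetric] by transfer (auto simp: when_def)
  then show ?thesis by simp
qed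

lemma quad_form_expand:
  assumes "A \<in> carrier_mat n n" "dim_vec v = n"
  shows "quad_form A v = (\<Sum>i<n. \<Sum>j<n. A $$ (i,j) *\<^sub>R (v $ i * v $ j))"
  using assms
  by (simp add: quad_form_def scalar_prod_def sum_distrib_left Const_mult atLeast0LessThan
      mult.left_commute)

lemma poly_subst_quad_form:
  assumes "A \<in> carrier_mat n n"
  shows "poly_subst f (quad_form A (var_vec n)) = (\<Sum>i<n. \<Sum>j<n. A $$ (i,j) *\<^sub>R (f i * f j))"
  using assms by (simp add: quad_form_expand[of A n] var_vec_def poly_subst_simps)


section \<open>Homogeneous polynomials and sums of squares\<close>

text \<open>Summing exponents over the fixed range \<open>{..<n}\<close> instead of the support
  makes the degree visibly additive, as \<open>hom_polys_mult\<close> needs.\<close>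

lemma hom_polys_iff:
  "p \<in> hom_polys n m \<longleftrightarrow> (\<forall>t\<in>Poly_Mapping.keys p. Poly_Mapping.keys t \<subseteq> {..<n} \<and>
     (\<Sum>i<n. Poly_Mapping.lookup t i) = m)"
proof -
  have eq: "(\<Sum>i\<in>Poly_Mapping.keys t. Poly_Mapping.lookup t i) = (\<Sum>i<n. Poly_Mapping.lookup t i)"
    if "Poly_Mapping.keys t \<subseteq> {..<n}" for t
    by (rule sum.mono_neutral_left) (use that in \<open>auto simp: in_keys_iff\<close>)
  show ?thesis
    unfolding hom_polys_def mem_Collect_eq
    by (intro ball_cong conj_cong refl) (drule eq, simp only:)
qed

lemma hom_polys_zero [simp]: "0 \<in> hom_polys n m"
  by (simp add: hom_polys_def)

lemma hom_polys_one [simp]: "1 \<in> hom_polys n 0"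
  by (simp add: hom_polys_def)

lemma hom_polys_Var: "i < n \<Longrightarrow> Var i \<in> hom_polys n 1"
  by (simp add: hom_polys_def Var_def)

lemma hom_polys_add: "p \<in> hom_polys n m \<Longrightarrow> q \<in> hom_polys n m \<Longrightarrow> p + q \<in> hom_polys n m"
  using keys_add[of p q] unfolding hom_polys_def by blast

lemma hom_polys_scaleR: "p \<in> hom_polys n m \<Longrightarrow> c *\<^sub>R p \<in> hom_polys n m"
  using keys_scaleR[of c p] unfolding hom_polys_def by blast

lemma hom_polys_diff: "p \<in> hom_polys n m \<Longrightarrow> q \<in> hom_polys n m \<Longrightarrow> p - q \<in> hom_polys n m"
  using hom_polys_add[of p n m "(-1) *\<^sub>R q"] hom_polys_scaleR[of q n m "-1"] by simp

lemma hom_polys_sum: "(\<And>i. i \<in> S \<Longrightarrow> f i \<in> hom_polys n m) \<Longrightarrow> sum f S \<in> hom_polys n m"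
  by (induction S rule: infinite_finite_induct) (auto intro: hom_polys_add)

lemma hom_polys_mult:
  assumes "p \<in> hom_polys n a" "q \<in> hom_polys n b"
  shows "p * q \<in> hom_polys n (a + b)"
  unfolding hom_polys_iff
proof
  fix t assume "t \<in> Poly_Mapping.keys (p * q)"
  then obtain r s where "t = r + s" "r \<in> Poly_Mapping.keys p" "s \<in> Poly_Mapping.keys q"
    using keys_mult[of p q] by blast
  then show "Poly_Mapping.keys t \<subseteq> {..<n} \<and> (\<Sum>i<n. Poly_Mapping.lookup t i) = a + b"
    using assms keys_add[of r s] unfolding hom_polys_iff
    by (force simp: lookup_add sum.distrib)
qed

lemma hom_polys_power: "p \<in> hom_polys n a \<Longrightarrow> p ^ k \<in> hom_polys n (a * k)"
  using hom_polys_mult[of p n a] by (induction k) simp_all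

lemma hom_polys_prod:
  "(\<And>i. i \<in> S \<Longrightarrow> f i \<in> hom_polys n (a i)) \<Longrightarrow> prod f S \<in> hom_polys n (sum a S)"
  by (induction S rule: infinite_finite_induct) (auto intro: hom_polys_mult)

text \<open>Each monomial of degree \<open>m\<close> becomes a product of \<open>m\<close> forms of
  degree \<open>a\<close>, counted with multiplicity.\<close>

lemma hom_polys_poly_subst:
  assumes p: "p \<in> hom_polys n m" and f: "\<And>i. i < n \<Longrightarrow> f i \<in> hom_polys n' a"
  shows "poly_subst f p \<in> hom_polys n' (a * m)"
  unfolding poly_subst_def
proof (intro hom_polys_sum hom_polys_scaleR)
  fix t assume t: "t \<in> Poly_Mapping.keys p"
  have "monom_subst f t \<in> hom_polys n' (\<Sum>i\<in>Poly_Mapping.keys t. a * Poly_Mapping.lookup t i)"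
    unfolding monom_subst_def
    by (intro hom_polys_prod hom_polys_power f) (use p t in \<open>auto simp: hom_polys_def\<close>)
  then show "monom_subst f t \<in> hom_polys n' (a * m)"
    using p t by (simp add: hom_polys_def flip: sum_distrib_left)
qed

text \<open>The parameter \<open>m\<close> is the degree of the squared forms, so the elements have
  degree \<open>2 * m\<close>. Besides the target \<open>sos4\<close>, the cases 0 and 1 are needed
  for the factors of a generator.\<close>

definition sos :: "nat \<Rightarrow> nat \<Rightarrow> rpoly set" where
  "sos n m = convex hull {\<theta>\<^sup>2 | \<theta>. \<theta> \<in> hom_polys n m}"

lemma sos4_eq: "sos4 n = sos n 2"
  by (simp add: sos4_def sos_def)

lemma convex_sos: "convex (sos n m)"
  by (simp add: sos_def)

lemma sos_square: "\<theta> \<in> hom_polys n m \<Longrightarrow> \<theta>\<^sup>2 \<in> sos n m"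
  unfolding sos_def by (rule hull_inc) blast

text \<open>The preimage of a convex set under a linear map is convex, so it contains the hull as
  soon as it contains the generators.\<close>

lemma linear_image_hull_subset:
  assumes "linear L" "convex T" "\<And>x. x \<in> S \<Longrightarrow> L x \<in> T" "p \<in> convex hull S"
  shows "L p \<in> T"
proof -
  have "convex hull S \<subseteq> L -` T"
    using assms by (intro hull_minimal convex_linear_vimage) auto
  then show ?thesis using assms(4) by blast
qed

lemma sos_scaleR:
  assumes "0 \<le> c" "p \<in> sos n m"
  shows "c *\<^sub>R p \<in> sos n m"
proof (rule linear_image_hull_subset[OF _ convex_sos _ assms(2)[unfolded sos_def]])
  show "linear (\<lambda>p :: rpoly. c *\<^sub>R p)" by (rule linear_scale_self)
  fix x assume "x \<in> {\<theta>\<^sup>2 | \<theta>. \<theta> \<in> hom_polys n m}"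
  then obtain \<theta> where \<theta>: "x = \<theta>\<^sup>2" "\<theta> \<in> hom_polys n m" by auto
  then have "c *\<^sub>R x = (sqrt c *\<^sub>R \<theta>)\<^sup>2" using assms(1) by (simp add: power2_eq_square)
  then show "c *\<^sub>R x \<in> sos n m" using \<theta> by (metis sos_square hom_polys_scaleR)
qed

lemma sos_add:
  assumes "p \<in> sos n m" "q \<in> sos n m"
  shows "p + q \<in> sos n m"
proof -
  \<comment> \<open>A sum is the midpoint of the doubled summands; convexity and closure under
    scaling thus give closure under addition.\<close>
  have "(1/2) *\<^sub>R (2 *\<^sub>R p) + (1/2) *\<^sub>R (2 *\<^sub>R q) \<in> sos n m"
    using assms by (intro convexD[OF convex_sos] sos_scaleR) auto
  then show ?thesis by simp
qed

lemma sos_zero [simp]: "0 \<in> sos n m"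
  using sos_square[OF hom_polys_zero] by simp

lemma sos_sum: "(\<And>i. i \<in> S \<Longrightarrow> f i \<in> sos n m) \<Longrightarrow> sum f S \<in> sos n m"
  by (induction S rule: infinite_finite_induct) (auto intro: sos_add)

text \<open>Multiplication is bilinear, so each factor in turn can be reduced to a single square,
  and a product of squares is a square.\<close>

lemma sos_mult:
  assumes p: "p \<in> sos n a" and q: "q \<in> sos n b"
  shows "p * q \<in> sos n (a + b)"
proof (rule linear_image_hull_subset[OF _ convex_sos _ p[unfolded sos_def]])
  show "linear (\<lambda>p. p * q)" by (rule linearI) (simp_all add: distrib_right)
  fix x assume "x \<in> {\<theta>\<^sup>2 | \<theta>. \<theta> \<in> hom_polys n a}"
  then obtain \<theta> where \<theta>: "x = \<theta>\<^sup>2" "\<theta> \<in> hom_polys n a" by auto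
  show "x * q \<in> sos n (a + b)"
  proof (rule linear_image_hull_subset[OF _ convex_sos _ q[unfolded sos_def]])
    show "linear (\<lambda>q. x * q)" by (rule linearI) (simp_all add: distrib_left)
    fix y assume "y \<in> {\<theta>\<^sup>2 | \<theta>. \<theta> \<in> hom_polys n b}"
    then obtain \<eta> where "y = \<eta>\<^sup>2" "\<eta> \<in> hom_polys n b" by auto
    then show "x * y \<in> sos n (a + b)"
      using \<theta> by (metis sos_square hom_polys_mult power_mult_distrib)
  qed
qed


section \<open>Indices and blocks\<close>

lemma blk_off_Suc: "1 \<le> h \<Longrightarrow> blk_off d (Suc h) = blk_off d h + blk_dim d h"
  by (simp add: blk_off_def)

lemma blk_off_2: "blk_off d 2 = d 1"
  by (simp add: blk_off_def blk_dim_def numeral_2_eq_2)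

lemma blk_off_add_le:
  assumes "1 \<le> h" "h < h'"
  shows "blk_off d h + blk_dim d h \<le> blk_off d h'"
  unfolding blk_off_Suc[OF assms(1), symmetric] unfolding blk_off_def
  using assms by (intro sum_mono2) auto

lemma total_dim_eq: "total_dim N d = blk_off d (Suc N)"
  by (simp add: total_dim_def blk_off_def atLeastLessThanSuc_atLeastAtMost)

lemma blk_index_less:
  assumes "h \<in> {1..N}" "k < blk_dim d h"
  shows "blk_off d h + k < total_dim N d"
  using blk_off_add_le[of h "Suc N" d] assms by (simp add: total_dim_eq)

text \<open>Position in the full vector of the coordinate carrying entry \<open>(i, j)\<close> of
  block \<open>h\<close>; \<open>max\<close> and \<open>min\<close> make it symmetric, so no case
  split on the triangle is needed.\<close>

definition mat_idx :: "(nat \<Rightarrow> nat) \<Rightarrow> nat \<Rightarrow> nat \<Rightarrow> nat \<Rightarrow> nat" where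
  "mat_idx d h i j = blk_off d h + (tri (max i j) + min i j)"

lemma tri_max_min_less: "i < m \<Longrightarrow> j < m \<Longrightarrow> tri (max i j) + min i j < tri m"
  by (rule tri_index_less) auto

lemma mat_idx_less:
  assumes "h \<in> {2..N}" "i < d h" "j < d h"
  shows "mat_idx d h i j < total_dim N d"
  unfolding mat_idx_def
  using assms tri_max_min_less[of i "d h" j] by (intro blk_index_less) (auto simp: blk_dim_def)

lemma smat_blk_index:
  assumes "h \<ge> 2" "i < d h" "j < d h"
  shows "smat (d h) (blk d h x) $$ (i,j) =
    (if i = j then 1 else 1 / sqrt 2) *\<^sub>R x $ mat_idx d h i j"
  using assms tri_max_min_less[of i "d h" j]
  by (simp add: smat_def blk_def blk_dim_def Let_def mat_idx_def)

lemma dim_smat [simp]: "dim_row (smat m v) = m" "dim_col (smat m v) = m"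
  by (simp_all add: smat_def)

definition var_mat :: "nat \<Rightarrow> (nat \<Rightarrow> nat) \<Rightarrow> nat \<Rightarrow> rpoly mat" where
  "var_mat N d h = smat (d h) (blk d h (var_vec (total_dim N d)))"

lemma dim_var_mat [simp]: "dim_row (var_mat N d h) = d h" "dim_col (var_mat N d h) = d h"
  by (simp_all add: var_mat_def)

lemma var_mat_index:
  assumes "h \<in> {2..N}" "i < d h" "j < d h"
  shows "var_mat N d h $$ (i,j) = (if i = j then 1 else 1 / sqrt 2) *\<^sub>R Var (mat_idx d h i j)"
  using assms mat_idx_less[of h N i d j] by (simp add: var_mat_def smat_blk_index var_vec_def)

lemma var_mat_sym:
  assumes "h \<in> {2..N}" "i < d h" "j < d h"
  shows "var_mat N d h $$ (i,j) = var_mat N d h $$ (j,i)"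
  using assms by (simp add: var_mat_index mat_idx_def max.commute min.commute)

lemma var_mat_hom:
  assumes "h \<in> {2..N}" "i < d h" "j < d h"
  shows "var_mat N d h $$ (i,j) \<in> hom_polys (total_dim N d) 1"
  unfolding var_mat_index[of h N i d j, OF assms]
  using assms by (intro hom_polys_scaleR hom_polys_Var mat_idx_less)

section \<open>Coordinates of the Jordan square\<close>

lemma dim_blk_square [simp]: "dim_vec (blk_square d h x) = blk_dim d h"
  by (simp add: blk_square_def blk_dim_def blk_def)

lemma length_concat_map_upt:
  "length (concat (map l [1..<Suc N])) = (\<Sum>k = 1..<Suc N. length (l k))"
  by (induction N) simp_all

lemma nth_concat_map_upt:
  assumes "h \<in> {1..N}" "k < length (l h)"
  shows "concat (map l [1..<Suc N]) ! ((\<Sum>k = 1..<h. length (l k)) + k) = l h ! k"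
  using assms
proof (induction N)
  case (Suc N)
  have eq: "concat (map l [1..<Suc (Suc N)]) = concat (map l [1..<Suc N]) @ l (Suc N)" by simp
  show ?case
  proof (cases "h = Suc N")
    case True
    then show ?thesis
      unfolding eq using nth_append_length_plus[of "concat (map l [1..<Suc N])"]
      by (simp only: length_concat_map_upt)
  next
    case False
    have "(\<Sum>k = 1..<h. length (l k)) + length (l h) = (\<Sum>k = 1..<Suc h. length (l k))"
      using Suc.prems by simp
    also have "\<dots> \<le> (\<Sum>k = 1..<Suc N. length (l k))"
      using Suc.prems False by (intro sum_mono2) auto
    finally have "(\<Sum>k = 1..<h. length (l k)) + k < length (concat (map l [1..<Suc N]))"
      unfolding length_concat_map_upt using Suc.prems by linarith
    then show ?thesis
      unfolding eq using Suc False by (simp only: nth_append if_True) auto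
  qed
qed simp

lemma dim_jordan_square [simp]: "dim_vec (jordan_square N d x) = total_dim N d"
  unfolding jordan_square_def dim_vec_of_list length_concat_map_upt
  by (simp add: total_dim_eq blk_off_def)

lemma jordan_square_index:
  assumes "h \<in> {1..N}" "k < blk_dim d h"
  shows "jordan_square N d x $ (blk_off d h + k) = blk_square d h x $ k"
  using nth_concat_map_upt[of h N k "\<lambda>h. list_of_vec (blk_square d h x)"] assms
  unfolding jordan_square_def vec_of_list_index
  by (simp add: blk_off_def list_of_vec_index)

lemma jordan_square_orthant:
  assumes "N \<ge> 1" "i < d 1"
  shows "jordan_square N d (var_vec (total_dim N d)) $ i = (Var i)\<^sup>2"
  using jordan_square_index[of 1 N i d] blk_index_less[of 1 N i d] assms
  by (simp add: blk_off_def blk_dim_def blk_square_def blk_def var_vec_def)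

text \<open>The generic matrix is symmetric, so an entry of its square is the inner product of rows
  \<open>i\<close> and \<open>j\<close>; \<open>svec\<close> adds the factor \<open>sqrt 2\<close>
  off the diagonal.\<close>

lemma jordan_square_mat:
  assumes h: "h \<in> {2..N}" and i: "i < d h" and j: "j < d h"
  shows "jordan_square N d (var_vec (total_dim N d)) $ mat_idx d h i j
    = (if i = j then 1 else sqrt 2) *\<^sub>R
      (\<Sum>k<d h. var_mat N d h $$ (i,k) * var_mat N d h $$ (j,k))"
proof -
  let ?X = "var_mat N d h"
  have XX: "(?X * ?X) $$ (a,b) = (\<Sum>k<d h. ?X $$ (a,k) * ?X $$ (b,k))"
    if "a < d h" "b < d h" for a b
    using that var_mat_sym[of h N _ d b, OF h]
    by (simp add: scalar_prod_def atLeast0LessThan)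
  then have sym: "(?X * ?X) $$ (min i j, max i j) = (?X * ?X) $$ (i,j)"
    using i j by (simp add: min_def max_def mult.commute)
  have "jordan_square N d (var_vec (total_dim N d)) $ mat_idx d h i j
      = svec (?X * ?X) $ (tri (max i j) + min i j)"
    unfolding mat_idx_def using h tri_max_min_less[OF i j]
    by (subst jordan_square_index) (auto simp: blk_dim_def blk_square_def var_mat_def)
  also have "\<dots> = (if i = j then 1 else sqrt 2) *\<^sub>R (?X * ?X) $$ (i,j)"
    using i j sym by (subst svec_index) (auto simp: min_def max_def)
  finally show ?thesis
    unfolding XX[OF i j] .
qed

text \<open>The scalings of \<open>svec\<close> and \<open>smat\<close> cancel, so the substitution
  replaces the generic matrix by its square, which is the Gram matrix of its rows.\<close>

lemma poly_subst_var_mat: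
  assumes "h \<in> {2..N}" "i < d h" "j < d h"
  shows "poly_subst (($) (jordan_square N d (var_vec (total_dim N d)))) (var_mat N d h $$ (i,j))
    = (\<Sum>k<d h. var_mat N d h $$ (i,k) * var_mat N d h $$ (j,k))"
proof -
  let ?J = "jordan_square N d (var_vec (total_dim N d))"
  have "poly_subst (($) ?J) (var_mat N d h $$ (i,j)) =
      (if i = j then 1 else 1 / sqrt 2) *\<^sub>R ?J $ mat_idx d h i j"
    by (simp only: var_mat_index[of h N i d j, OF assms] poly_subst_scaleR poly_subst_Var)
  also have "\<dots> = (\<Sum>k<d h. var_mat N d h $$ (i,k) * var_mat N d h $$ (j,k))"
    unfolding jordan_square_mat[of h N i d j, OF assms] by (cases "i = j") simp_all
  finally show ?thesis .
qed

lemma total_index_ex: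
  assumes "k < total_dim N d"
  obtains h l where "h \<in> {1..N}" "l < blk_dim d h" "k = blk_off d h + l"
  using assms
proof (induction N arbitrary: thesis)
  case (Suc N)
  show ?case
  proof (cases "k < total_dim N d")
    case True
    then show ?thesis using Suc by (metis atLeastAtMost_iff le_SucI)
  next
    case False
    moreover have "k < total_dim N d + blk_dim d (Suc N)"
      using Suc.prems(2) by (simp add: total_dim_def)
    ultimately show ?thesis
      by (intro Suc.prems(1)[of "Suc N" "k - total_dim N d"]) (auto simp: total_dim_eq)
  qed
qed (simp add: total_dim_def)

lemma jordan_square_hom:
  assumes "k < total_dim N d"
  shows "jordan_square N d (var_vec (total_dim N d)) $ k \<in> hom_polys (total_dim N d) 2"
  using assms
proof (rule total_index_ex)
  fix h l assume h: "h \<in> {1..N}" and l: "l < blk_dim d h" and k: "k = blk_off d h + l"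
  show ?thesis
  proof (cases "h = 1")
    case True
    then show ?thesis
      using h k l assms hom_polys_power[OF hom_polys_Var[OF assms], of 2] jordan_square_orthant[of N k d]
      by (auto simp: blk_off_def blk_dim_def)
  next
    case False
    then have h2: "h \<in> {2..N}" using h by auto
    have "l < tri (d h)" using l False by (simp add: blk_dim_def)
    then obtain i j where ij: "i \<le> j" "j < d h" "l = tri j + i" by (rule tri_index_ex)
    then have i: "i < d h" and k': "k = mat_idx d h i j" using k by (simp_all add: mat_idx_def)
    have "var_mat N d h $$ (i,m) * var_mat N d h $$ (j,m) \<in> hom_polys (total_dim N d) (1 + 1)"
      if "m < d h" for m
      using h2 i ij that by (intro hom_polys_mult var_mat_hom)
    then show ?thesis
      unfolding k' jordan_square_mat[of h N i d j, OF h2 i ij(2)]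
      by (intro hom_polys_scaleR hom_polys_sum) (simp add: numeral_2_eq_2)
  qed
qed

lemma nonneg_idx_cases:
  assumes "i \<in> nonneg_idx N d"
  obtains "i < d 1" | h k where "h \<in> {2..N}" "k < d h" "i = mat_idx d h k k"
  using assms unfolding nonneg_idx_def mat_idx_def by (fastforce simp: add.assoc)

text \<open>An orthant coordinate becomes the square of a variable; a diagonal entry becomes the
  squared norm of a row of linear forms.\<close>

lemma jordan_square_nonneg_idx:
  assumes "N \<ge> 1" "i \<in> nonneg_idx N d"
  shows "jordan_square N d (var_vec (total_dim N d)) $ i \<in> sos (total_dim N d) 1"
  using assms(2)
proof (cases rule: nonneg_idx_cases)
  case 1
  then show ?thesis
    using assms(1) blk_index_less[of 1 N i d]
    by (auto simp: jordan_square_orthant blk_dim_def blk_off_def intro!: sos_square hom_polys_Var[simplified])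
next
  case (2 h k)
  have "var_mat N d h $$ (k,m) * var_mat N d h $$ (k,m) \<in> sos (total_dim N d) 1" if "m < d h" for m
    using sos_square[OF var_mat_hom[of h N k d m]] 2 that by (simp add: power2_eq_square)
  then show ?thesis
    unfolding 2(3) jordan_square_mat[of h N k d k, OF 2(1,2,2)] by (auto intro!: sos_sum)
qed


section \<open>The generators of the ZVP-type cone\<close>

lemma det_2x2:
  fixes A :: "'a::comm_ring_1 mat"
  assumes "A \<in> carrier_mat 2 2"
  shows "det A = A $$ (0,0) * A $$ (1,1) - A $$ (0,1) * A $$ (1,0)"
proof -
  have "det A = (\<Sum>j<2. A $$ (0,j) * cofactor A 0 j)"
    by (rule laplace_expansion_row[OF assms]) simp
  also have "\<dots> = A $$ (0,0) * cofactor A 0 0 + A $$ (0,1) * cofactor A 0 1"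
    by (simp add: numeral_2_eq_2)
  also have "cofactor A 0 0 = A $$ (1,1)"
    using assms by (simp add: cofactor_def det_single mat_delete_def)
  also have "cofactor A 0 1 = - A $$ (1,0)"
    using assms by (simp add: cofactor_def det_single mat_delete_def)
  finally show ?thesis by simp
qed

lemma minor_single:
  assumes "i < dim_row A" "dim_col A = dim_row A"
  shows "det (submatrix A {i} {i}) = A $$ (i,i)"
proof -
  have "{k. k < dim_row A \<and> k \<in> {i}} = {i}" using assms by auto
  moreover have "pick {i} 0 = i" by (auto intro!: Least_equality)
  ultimately have "submatrix A {i} {i} = mat 1 1 (\<lambda>_. A $$ (i,i))"
    by (intro eq_matI) (simp_all add: submatrix_def assms(2) del: pick.simps)
  then show ?thesis by (simp add: det_single)
qed

text \<open>\<open>pick\<close> enumerates an index set in increasing order, so rows 0 and 1 of the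
  submatrix are rows \<open>i\<close> and \<open>j\<close>.\<close>

lemma minor_pair:
  fixes A :: "'a::comm_ring_1 mat"
  assumes "i < j" "j < dim_row A" "dim_col A = dim_row A"
  shows "det (submatrix A {i,j} {i,j}) = A $$ (i,i) * A $$ (j,j) - A $$ (i,j) * A $$ (j,i)"
proof -
  have "{k. k < dim_row A \<and> k \<in> {i,j}} = {i,j}" using assms by auto
  then have card: "card {k. k < dim_row A \<and> k \<in> {i,j}} = 2" using assms(1) by simp
  have p0: "pick {i,j} 0 = i"
    using assms(1) by (auto intro!: Least_equality)
  have p1: "pick {i,j} (Suc 0) = j"
    unfolding pick.simps(2) p0 using assms(1) by (auto intro!: Least_equality)
  have "submatrix A {i,j} {i,j} \<in> carrier_mat 2 2"
    using card assms(3) by (intro carrier_matI) (simp_all only: dim_submatrix)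
  then show ?thesis
    using card assms(3) by (simp add: det_2x2 submatrix_index p0 p1 del: pick.simps insert_iff)
qed

text \<open>The degree of a minor is the size of its index set, so the bound leaves sizes 1 and 2. A
  minor of size 1 is a diagonal variable and joins the other linear generators as a sum of variables
  over \<open>nonneg_idx\<close>.\<close>

lemma cone_polys_cases:
  assumes "(g, e) \<in> cone_polys N d" "e \<le> 2"
  obtains S where "e = 1" "S \<subseteq> nonneg_idx N d" "g = sum Var S"
  | h i j where "e = 2" "h \<in> {2..N}" "i < j" "j < d h"
      "g = var_mat N d h $$ (i,i) * var_mat N d h $$ (j,j) - (var_mat N d h $$ (i,j))\<^sup>2"
  using assms(1) unfolding cone_polys_def
proof (elim UnE)
  assume "(g, e) \<in> {(Var i, 1) | i. i < d 1}"
  then obtain i where "g = Var i" "e = 1" "i < d 1" by auto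
  then show ?thesis using that(1)[of "{i}"] by (auto simp: nonneg_idx_def)
next
  assume "(g, e) \<in> {(\<Sum>i\<in>nonneg_idx N d. Var i, 1)}"
  then show ?thesis using that(1) by auto
next
  assume "(g, e) \<in> {(det (submatrix (smat (d h) (blk d h (var_vec (total_dim N d)))) I I), card I) | h I.
    h \<in> {2..N} \<and> I \<subseteq> {..<d h} \<and> I \<noteq> {}}"
  then obtain h I where h: "h \<in> {2..N}" and I: "I \<subseteq> {..<d h}" "I \<noteq> {}"
    and g: "g = det (submatrix (var_mat N d h) I I)" and e: "e = card I"
    unfolding var_mat_def by auto
  have "finite I" using I(1) finite_subset by blast
  then have "card I = 1 \<or> card I = 2" using I(2) assms(2) e by (cases "card I") auto
  then show ?thesis
  proof
    assume "card I = 1"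
    then obtain i where i: "I = {i}" by (rule card_1_singletonE)
    then have "i < d h" using I by simp
    then have "g = Var (mat_idx d h i i)"
      using h by (simp add: g i minor_single var_mat_index)
    moreover have "mat_idx d h i i \<in> nonneg_idx N d"
      using h \<open>i < d h\<close> unfolding nonneg_idx_def mat_idx_def by (auto simp: add.assoc)
    ultimately show ?thesis
      using \<open>card I = 1\<close> e by (intro that(1)[of "{mat_idx d h i i}"]) simp_all
  next
    assume "card I = 2"
    then obtain i j where ij: "I = {i,j}" "i < j"
      by (metis card_2_iff insert_commute linorder_neqE_nat)
    then have "i < d h" "j < d h" using I by simp_all
    then have "g = var_mat N d h $$ (i,i) * var_mat N d h $$ (j,j) - (var_mat N d h $$ (i,j))\<^sup>2"
      using ij h var_mat_sym[of h N j d i] by (simp add: g minor_pair power2_eq_square)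
    then show ?thesis using that(2) h ij \<open>j < d h\<close> \<open>card I = 2\<close> e by blast
  qed
qed

text \<open>Serves both halves of the theorem: \<open>L\<close> is the substitution of the Jordan
  square for the inclusion, and the sum of two point evaluations for the separation. Total degree 2
  allows no factor, one quadratic factor, or two linear ones.\<close>

lemma E2_linear_image:
  assumes p: "p \<in> E2 n (cone_polys N d)" and "linear L" "convex T"
    and square: "\<And>\<psi>. \<psi> \<in> hom_polys n 1 \<Longrightarrow> L (\<psi>\<^sup>2) \<in> T"
    and product: "\<And>\<psi> S S'. \<psi> \<in> hom_polys n 0 \<Longrightarrow> S \<subseteq> nonneg_idx N d \<Longrightarrow> S' \<subseteq> nonneg_idx N d \<Longrightarrow>
      L (\<psi>\<^sup>2 * (sum Var S * sum Var S')) \<in> T"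
    and minor: "\<And>\<psi> h i j. \<psi> \<in> hom_polys n 0 \<Longrightarrow> h \<in> {2..N} \<Longrightarrow> i < j \<Longrightarrow> j < d h \<Longrightarrow>
      L (\<psi>\<^sup>2 * (var_mat N d h $$ (i,i) * var_mat N d h $$ (j,j) - (var_mat N d h $$ (i,j))\<^sup>2)) \<in> T"
  shows "L p \<in> T"
proof (rule linear_image_hull_subset[OF assms(2,3) _ p[unfolded E2_def]])
  fix x assume "x \<in> {\<psi>\<^sup>2 * prod_list (map fst gs) | \<psi> gs.
     set gs \<subseteq> cone_polys N d \<and> sum_list (map snd gs) \<le> 2 \<and> even (2 - sum_list (map snd gs)) \<and>
     \<psi> \<in> hom_polys n ((2 - sum_list (map snd gs)) div 2)}"
  then obtain \<psi> gs where x: "x = \<psi>\<^sup>2 * prod_list (map fst gs)" and gs: "set gs \<subseteq> cone_polys N d"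
    and le: "sum_list (map snd gs) \<le> 2" and ev: "even (2 - sum_list (map snd gs))"
    and \<psi>: "\<psi> \<in> hom_polys n ((2 - sum_list (map snd gs)) div 2)"
    by auto
  \<comment> \<open>Every usable generator has positive degree, which bounds the number of factors
    by two.\<close>
  have pos: "1 \<le> snd g" if "g \<in> cone_polys N d" "snd g \<le> 2" for g
    using that by (cases g) (auto elim: cone_polys_cases)
  consider "gs = []" | a where "gs = [a]" | a b cs where "gs = a # b # cs"
    by (metis list.exhaust)
  then show "L x \<in> T"
  proof cases
    case 1
    then show ?thesis using square x \<psi> by simp
  next
    case (2 a)
    \<comment> \<open>A lone linear factor would leave the odd degree 1 for the square.\<close>
    then have "snd a = 2" using pos[of a] gs le ev by (cases "snd a = 1") auto
    moreover have "(fst a, snd a) \<in> cone_polys N d" using gs 2 by simp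
    ultimately show ?thesis
      using 2 x \<psi> minor[of \<psi>] by (auto elim!: cone_polys_cases)
  next
    case (3 a b cs)
    then have sum: "snd a + snd b + sum_list (map snd cs) \<le> 2" using le by simp
    then have "1 \<le> snd a" "1 \<le> snd b" using pos[of a] pos[of b] gs 3 by auto
    with sum have ab: "snd a = 1" "snd b = 1" and cs0: "sum_list (map snd cs) = 0" by linarith+
    have "cs = []"
    proof (cases cs)
      case (Cons c cs')
      then show ?thesis using pos[of c] gs 3 cs0 by auto
    qed simp
    moreover have "(fst a, snd a) \<in> cone_polys N d" "(fst b, snd b) \<in> cone_polys N d"
      using gs 3 by simp_all
    then obtain S S' where "S \<subseteq> nonneg_idx N d" "fst a = sum Var S"
        "S' \<subseteq> nonneg_idx N d" "fst b = sum Var S'"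
      unfolding ab by (elim cone_polys_cases) auto
    ultimately show ?thesis using 3 x \<psi> ab product[of \<psi> S S'] by simp
  qed
qed


section \<open>The inclusion\<close>

text \<open>Expanding the square gives three double sums that factor. Ordered pairs count each 2 by
  2 minor twice; keeping the factor 2 avoids division in the ring.\<close>

lemma lagrange_identity:
  fixes a b :: "nat \<Rightarrow> 'a::comm_ring_1"
  shows "(\<Sum>k<m. \<Sum>l<m. (a k * b l - a l * b k)\<^sup>2) =
    2 * ((\<Sum>k<m. a k * a k) * (\<Sum>k<m. b k * b k) - (\<Sum>k<m. a k * b k)\<^sup>2)"
proof -
  have "(\<Sum>k<m. \<Sum>l<m. (a k * b l - a l * b k)\<^sup>2) =
    (\<Sum>k<m. \<Sum>l<m. a k * a k * (b l * b l)) + (\<Sum>k<m. \<Sum>l<m. b k * b k * (a l * a l))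
      - 2 * (\<Sum>k<m. \<Sum>l<m. a k * b k * (a l * b l))"
    unfolding sum_distrib_left sum.distrib[symmetric] sum_subtractf[symmetric]
    by (intro sum.cong refl) (simp add: power2_eq_square algebra_simps)
  then show ?thesis
    unfolding sum_product[symmetric] by (simp add: power2_eq_square algebra_simps)
qed

lemma quad_form_jordan_square:
  assumes "A \<in> carrier_mat (total_dim N d) (total_dim N d)"
  shows "quad_form A (jordan_square N d x) =
    poly_subst (($) (jordan_square N d x)) (quad_form A (var_vec (total_dim N d)))"
  unfolding poly_subst_quad_form[OF assms] by (rule quad_form_expand[OF assms]) simp

lemma K_ZVP0_subset_K_NN0:
  assumes "N \<ge> 1"
  shows "K_ZVP0 N d \<subseteq> K_NN0 N d"
proof
  fix A assume A: "A \<in> K_ZVP0 N d"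
  let ?n = "total_dim N d"
  let ?J = "jordan_square N d (var_vec ?n)"
  let ?L = "poly_subst (($) ?J)"
  have "?L (quad_form A (var_vec ?n)) \<in> sos ?n 2"
  proof (rule E2_linear_image[OF _ linear_poly_subst convex_sos])
    show "quad_form A (var_vec ?n) \<in> E2 ?n (cone_polys N d)"
      using A by (simp add: K_ZVP0_def Let_def)
  next
    fix \<psi> assume "\<psi> \<in> hom_polys ?n 1"
    then have "?L \<psi> \<in> hom_polys ?n (2 * 1)"
      by (rule hom_polys_poly_subst) (rule jordan_square_hom)
    then show "?L (\<psi>\<^sup>2) \<in> sos ?n 2" by (simp add: poly_subst_power2 sos_square)
  next
    fix \<psi> S S' assume \<psi>: "\<psi> \<in> hom_polys ?n 0" and S: "S \<subseteq> nonneg_idx N d" "S' \<subseteq> nonneg_idx N d"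
    have "?L \<psi> \<in> hom_polys ?n (2 * 0)"
      using \<psi> by (rule hom_polys_poly_subst) (rule jordan_square_hom)
    then have "?L (\<psi>\<^sup>2) \<in> sos ?n 0" by (simp add: poly_subst_power2 sos_square)
    moreover have "?L (sum Var R) \<in> sos ?n 1" if "R \<subseteq> nonneg_idx N d" for R
      using jordan_square_nonneg_idx[OF assms] that
      by (auto simp: poly_subst_sum intro!: sos_sum)
    ultimately have "?L (\<psi>\<^sup>2) * (?L (sum Var S) * ?L (sum Var S')) \<in> sos ?n (0 + (1 + 1))"
      using S by (intro sos_mult)
    then show "?L (\<psi>\<^sup>2 * (sum Var S * sum Var S')) \<in> sos ?n 2"
      by (simp add: poly_subst_mult numeral_2_eq_2)
  next
    fix \<psi> h i j assume \<psi>: "\<psi> \<in> hom_polys ?n 0" and h: "h \<in> {2..N}" and ij: "i < j" "j < d h"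
    let ?X = "var_mat N d h"
    let ?m = "?X $$ (i,i) * ?X $$ (j,j) - (?X $$ (i,j))\<^sup>2"
    have "?L \<psi> \<in> hom_polys ?n (2 * 0)"
      using \<psi> by (rule hom_polys_poly_subst) (rule jordan_square_hom)
    then have "?L (\<psi>\<^sup>2) \<in> sos ?n 0" by (simp add: poly_subst_power2 sos_square)
    moreover have "?L ?m \<in> sos ?n 2"
    proof -
      let ?s = "\<Sum>k<d h. \<Sum>l<d h. (?X $$ (i,k) * ?X $$ (j,l) - ?X $$ (i,l) * ?X $$ (j,k))\<^sup>2"
      have "?X $$ (i,k) * ?X $$ (j,l) - ?X $$ (i,l) * ?X $$ (j,k) \<in> hom_polys ?n (1 + 1)"
        if "k < d h" "l < d h" for k l
        using that h ij by (intro hom_polys_diff hom_polys_mult var_mat_hom) simp_all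
      then have "?s \<in> sos ?n 2"
        by (intro sos_sum sos_square) (simp add: numeral_2_eq_2)
      \<comment> \<open>The substituted minor is the Gram determinant of rows \<open>i\<close> and
        \<open>j\<close>, to which Lagrange's identity applies.\<close>
      moreover have "?s = 2 *\<^sub>R ?L ?m"
        using h ij unfolding lagrange_identity
        by (simp add: poly_subst_simps poly_subst_var_mat scaleR_2)
      then have "?L ?m = (1/2) *\<^sub>R ?s" by simp
      ultimately show ?thesis using sos_scaleR[of "1/2" ?s] by simp
    qed
    ultimately have "?L (\<psi>\<^sup>2) * ?L ?m \<in> sos ?n (0 + 2)" by (rule sos_mult)
    then show "?L (\<psi>\<^sup>2 * ?m) \<in> sos ?n 2" by (simp only: poly_subst_mult add_0)
  qed
  then show "A \<in> K_NN0 N d"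
    using A by (simp add: K_ZVP0_def K_NN0_def Let_def sos4_eq sym_mats_def quad_form_jordan_square)
qed


section \<open>Strictness\<close>

text \<open>Block 2 starts at \<open>d 1\<close> and has length at least 3 because
  \<open>d 2 \<ge> 2\<close>, so later blocks cannot reach its first three positions.\<close>

lemma mat_idx_eq_iff:
  assumes "d 2 \<ge> 2" "h \<ge> 2" "i \<le> j" "c < 3"
  shows "mat_idx d h i j = d 1 + c \<longleftrightarrow> h = 2 \<and> tri j + i = c"
proof (cases "h = 2")
  case True
  then show ?thesis using assms(3) by (simp add: mat_idx_def blk_off_2)
next
  case False
  then have "blk_off d 2 + blk_dim d 2 \<le> blk_off d h"
    using assms(2) by (intro blk_off_add_le) auto
  moreover have "tri 2 \<le> tri (d 2)" using assms(1) by (rule tri_mono)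
  then have "3 \<le> blk_dim d 2" by (simp add: blk_dim_def numeral_2_eq_2)
  ultimately show ?thesis using False assms(4) by (simp add: mat_idx_def blk_off_2)
qed

lemma tri_add_eq_iff:
  assumes "i \<le> j"
  shows "tri j + i = 0 \<longleftrightarrow> j = 0" "tri j + i = 1 \<longleftrightarrow> i = 0 \<and> j = 1"
    "tri j + i = 2 \<longleftrightarrow> i = 1 \<and> j = 1"
proof -
  consider "j = 0" | "j = 1" | "tri 2 \<le> tri j" "j \<ge> 2"
    using tri_mono[of 2 j] by linarith
  then show "tri j + i = 0 \<longleftrightarrow> j = 0" "tri j + i = 1 \<longleftrightarrow> i = 0 \<and> j = 1"
    "tri j + i = 2 \<longleftrightarrow> i = 1 \<and> j = 1"
    by (cases; use assms in \<open>auto simp: numeral_2_eq_2\<close>)+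
qed

text \<open>A quadratic form sees only the symmetric part of its matrix, so a product of two linear
  forms can be represented by a symmetric matrix.\<close>

lemma sum_symmetrized_product:
  fixes v :: "nat \<Rightarrow> 'a::{comm_ring_1,real_algebra_1}"
  shows "(\<Sum>i<n. \<Sum>j<n. ((b i * c j + c i * b j) / 2) *\<^sub>R (v i * v j)) =
    (\<Sum>i<n. b i *\<^sub>R v i) * (\<Sum>i<n. c i *\<^sub>R v i)"
proof -
  have "(\<Sum>i<n. \<Sum>j<n. ((b i * c j + c i * b j) / 2) *\<^sub>R (v i * v j)) =
    (1/2) *\<^sub>R ((\<Sum>i<n. \<Sum>j<n. (b i *\<^sub>R v i) * (c j *\<^sub>R v j)) +
      (\<Sum>i<n. \<Sum>j<n. (c i *\<^sub>R v i) * (b j *\<^sub>R v j)))"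
    unfolding sum.distrib[symmetric] scaleR_sum_right
    by (intro sum.cong refl) (simp add: scaleR_add_left scaleR_add_right add_divide_distrib mult.commute)
  also have "\<dots> = (\<Sum>i<n. b i *\<^sub>R v i) * (\<Sum>i<n. c i *\<^sub>R v i)"
    unfolding sum_product[symmetric] by (simp add: mult.commute flip: scaleR_2)
  finally show ?thesis .
qed

lemma sum_of_bool_scaleR:
  "m < n \<Longrightarrow> (\<Sum>j<n. of_bool (j = m) *\<^sub>R f j) = (f (m :: nat) :: 'a::real_vector)"
  by (subst sum.remove[of _ m]) auto

text \<open>The symmetrized product of the linear forms with coefficients \<open>b\<close> and
  \<open>c\<close>. Position \<open>d 1 + 1\<close> holds the off-diagonal entry times
  \<open>sqrt 2\<close>, so the coefficient \<open>- sqrt 2\<close> there yields minus twice that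
  entry.\<close>

definition sep_mat :: "nat \<Rightarrow> (nat \<Rightarrow> nat) \<Rightarrow> real mat" where
  "sep_mat N d =
    (let b = (\<lambda>i. of_bool (i = 0));
         c = (\<lambda>i. of_bool (i = d 1) + of_bool (i = d 1 + 2) - sqrt 2 * of_bool (i = d 1 + 1))
     in mat (total_dim N d) (total_dim N d) (\<lambda>(i,j). (b i * c j + c i * b j) / 2))"

text \<open>The value \<open>sqrt 2\<close> is the \<open>svec\<close> coordinate of an off-diagonal
  entry equal to 1.\<close>

definition sep_pt1 :: "(nat \<Rightarrow> nat) \<Rightarrow> nat \<Rightarrow> real" where
  "sep_pt1 d k = (if k = 0 then 1 else if k = d 1 + 1 then sqrt 2 else 0)"

definition sep_pt2 :: "(nat \<Rightarrow> nat) \<Rightarrow> nat \<Rightarrow> real" where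
  "sep_pt2 d k = (if k = d 1 \<or> k = d 1 + 2 then 1 else 0)"

definition sep_dual :: "nat \<Rightarrow> (nat \<Rightarrow> nat) \<Rightarrow> real mat" where
  "sep_dual N d = mat (total_dim N d) (total_dim N d)
     (\<lambda>(i,j). sep_pt1 d i * sep_pt1 d j + sep_pt2 d i * sep_pt2 d j)"

lemma sep_mat_sym: "sep_mat N d \<in> sym_mats (total_dim N d)"
  by (auto simp: sep_mat_def sym_mats_def Let_def intro!: eq_matI)

lemma sep_dual_sym: "sep_dual N d \<in> sym_mats (total_dim N d)"
  by (auto simp: sep_dual_def sym_mats_def mult.commute intro!: eq_matI)

lemma mat_inner_sep_dual:
  assumes "A \<in> carrier_mat (total_dim N d) (total_dim N d)"
  shows "mat_inner (sep_dual N d) A =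
    poly_subst (sep_pt1 d) (quad_form A (var_vec (total_dim N d))) +
    poly_subst (sep_pt2 d) (quad_form A (var_vec (total_dim N d)))"
  unfolding poly_subst_quad_form[OF assms] mat_inner_def
  by (simp add: sep_dual_def algebra_simps sum.distrib)

lemma total_dim_ge:
  assumes "N \<ge> 2" "d 2 \<ge> 2"
  shows "d 1 + 3 \<le> total_dim N d"
proof -
  have "mat_idx d 2 1 1 < total_dim N d"
    using assms by (intro mat_idx_less) auto
  then show ?thesis by (simp add: mat_idx_def blk_off_2)
qed

lemma poly_subst_sep_mat:
  assumes "N \<ge> 2" "d 2 \<ge> 2"
  shows "poly_subst v (quad_form (sep_mat N d) (var_vec (total_dim N d))) =
    v 0 * (v (d 1) + v (d 1 + 2) - sqrt 2 *\<^sub>R v (d 1 + 1))"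
proof -
  let ?n = "total_dim N d"
  have c: "sep_mat N d \<in> carrier_mat ?n ?n"
    using sep_mat_sym by (auto simp: sym_mats_def)
  have "poly_subst v (quad_form (sep_mat N d) (var_vec ?n)) =
    (\<Sum>i<?n. of_bool (i = 0) *\<^sub>R v i) *
    (\<Sum>i<?n. (of_bool (i = d 1) + of_bool (i = d 1 + 2) - sqrt 2 * of_bool (i = d 1 + 1)) *\<^sub>R v i)"
    unfolding poly_subst_quad_form[OF c] sum_symmetrized_product[symmetric]
    by (intro sum.cong refl) (simp add: sep_mat_def Let_def)
  also have "\<dots> = v 0 * (v (d 1) + v (d 1 + 2) - sqrt 2 *\<^sub>R v (d 1 + 1))"
    using total_dim_ge[of N d, OF assms]
    by (simp add: scaleR_add_left scaleR_diff_left sum.distrib sum_subtractf sum_of_bool_scaleR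
        flip: scaleR_scaleR scaleR_sum_right del: of_bool_eq_iff)
  finally show ?thesis .
qed

lemma sep_mat_K_NN0:
  assumes "N \<ge> 2" "d 1 \<ge> 1" "d 2 \<ge> 2"
  shows "sep_mat N d \<in> K_NN0 N d"
proof -
  let ?n = "total_dim N d"
  let ?J = "jordan_square N d (var_vec ?n)"
  let ?X = "var_mat N d 2"
  have c: "sep_mat N d \<in> carrier_mat ?n ?n"
    using sep_mat_sym by (auto simp: sym_mats_def)
  have idx: "d 1 = mat_idx d 2 0 0" "d 1 + 2 = mat_idx d 2 1 1" "d 1 + 1 = mat_idx d 2 0 1"
    by (simp_all add: mat_idx_def blk_off_2)
  have h: "2 \<in> {2..N}" and lt: "0 < d 2" "1 < d 2" using assms by auto
  have "?J $ (d 1) + ?J $ (d 1 + 2) - sqrt 2 *\<^sub>R ?J $ (d 1 + 1) =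
    (\<Sum>k<d 2. ?X $$ (0,k) * ?X $$ (0,k)) + (\<Sum>k<d 2. ?X $$ (1,k) * ?X $$ (1,k))
      - 2 *\<^sub>R (\<Sum>k<d 2. ?X $$ (0,k) * ?X $$ (1,k))"
    unfolding idx(2,3) by (subst idx(1)) (use h lt in \<open>simp add: jordan_square_mat\<close>)
  \<comment> \<open>This is the squared norm of the difference of the first two rows of the generic
    matrix.\<close>
  also have "\<dots> = (\<Sum>k<d 2. (?X $$ (0,k) - ?X $$ (1,k))\<^sup>2)"
    unfolding scaleR_sum_right sum.distrib[symmetric] sum_subtractf[symmetric]
    by (intro sum.cong refl) (simp add: power2_eq_square algebra_simps scaleR_2)
  also have "\<dots> \<in> sos ?n 1"
    using h lt by (intro sos_sum sos_square hom_polys_diff var_mat_hom) auto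
  finally have 1: "?J $ (d 1) + ?J $ (d 1 + 2) - sqrt 2 *\<^sub>R ?J $ (d 1 + 1) \<in> sos ?n 1" .
  have "0 \<in> nonneg_idx N d" using assms(2) by (simp add: nonneg_idx_def)
  then have "?J $ 0 \<in> sos ?n 1" using assms(1) by (intro jordan_square_nonneg_idx) simp_all
  from sos_mult[OF this 1] have "quad_form (sep_mat N d) ?J \<in> sos ?n 2"
    by (simp add: quad_form_jordan_square[OF c] poly_subst_sep_mat[of N d, OF assms(1,3)] numeral_2_eq_2)
  then show ?thesis
    using sep_mat_sym by (simp add: K_NN0_def Let_def sos4_eq)
qed

section \<open>Sign of the separating functional on the ZVP-type generators\<close>

lemma sep_pt_nonneg: "0 \<le> sep_pt1 d k" "0 \<le> sep_pt2 d k"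
  by (simp_all add: sep_pt1_def sep_pt2_def)

text \<open>All diagonal coordinates vanish at \<open>sep_pt1\<close> and all off-diagonal ones at
  \<open>sep_pt2\<close>. The only negative contribution is -1, from the leading minor of block 2 at
  \<open>sep_pt1\<close>; the same minor is 1 at \<open>sep_pt2\<close>.\<close>

lemma sep_pt_minor:
  assumes "d 1 \<ge> 1" "d 2 \<ge> 2" and h: "h \<in> {2..N}" and ij: "i < j" "j < d h"
  defines "m \<equiv> var_mat N d h $$ (i,i) * var_mat N d h $$ (j,j) - (var_mat N d h $$ (i,j))\<^sup>2"
  shows "0 \<le> poly_subst (sep_pt1 d) m + poly_subst (sep_pt2 d) m"
proof -
  have m: "poly_subst f m = f (mat_idx d h i i) * f (mat_idx d h j j) - (f (mat_idx d h i j))\<^sup>2 / 2"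
    for f :: "nat \<Rightarrow> real"
    using h ij by (simp add: m_def var_mat_index poly_subst_simps power_divide)
  \<comment> \<open>Since \<open>d 1 \<ge> 1\<close>, index 0 is an orthant coordinate, so the entry
    1 of \<open>sep_pt1\<close> there never enters a minor.\<close>
  have ne0: "mat_idx d h k l \<noteq> 0" for k l
    using h assms(1) blk_off_add_le[of 1 h d] by (simp add: mat_idx_def blk_dim_def)
  have eq: "mat_idx d h k l = d 1 \<longleftrightarrow> h = 2 \<and> l = 0"
    "mat_idx d h k l = Suc (d 1) \<longleftrightarrow> h = 2 \<and> k = 0 \<and> l = 1"
    "mat_idx d h k l = Suc (Suc (d 1)) \<longleftrightarrow> h = 2 \<and> k = 1 \<and> l = 1" if "k \<le> l" for k l
    using h mat_idx_eq_iff[of d h k l 0] mat_idx_eq_iff[of d h k l 1] mat_idx_eq_iff[of d h k l 2]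
      tri_add_eq_iff[of k l] that assms(2) by auto
  show ?thesis
    using ij unfolding m sep_pt1_def sep_pt2_def by (auto simp: eq[simplified] ne0)
qed

lemma sep_dual_DNN_ZVP:
  assumes "d 1 \<ge> 1" "d 2 \<ge> 2"
  shows "sep_dual N d \<in> DNN_ZVP N d"
proof -
  let ?n = "total_dim N d"
  let ?L = "\<lambda>p. poly_subst (sep_pt1 d) p + poly_subst (sep_pt2 d) p"
  have "0 \<le> mat_inner (sep_dual N d) A" if A: "A \<in> K_ZVP0 N d" for A
  proof -
    have c: "A \<in> carrier_mat ?n ?n" using A by (auto simp: K_ZVP0_def Let_def sym_mats_def)
    have "?L (quad_form A (var_vec ?n)) \<in> {0..}"
    proof (rule E2_linear_image[where L = ?L])
      show "quad_form A (var_vec ?n) \<in> E2 ?n (cone_polys N d)"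
        using A by (simp add: K_ZVP0_def Let_def)
      show "linear ?L" by (intro linear_compose_add linear_poly_subst)
      show "convex {0::real..}" by (rule convex_real_interval)
      show "?L (\<psi>\<^sup>2) \<in> {0..}" for \<psi> by (simp add: poly_subst_power2)
      show "?L (\<psi>\<^sup>2 * (sum Var S * sum Var S')) \<in> {0..}" for \<psi> S S'
        by (simp add: poly_subst_simps)
          (intro add_nonneg_nonneg mult_nonneg_nonneg sum_nonneg zero_le_power2 sep_pt_nonneg)
      fix \<psi> h i j
      assume \<psi>: "\<psi> \<in> hom_polys ?n 0" and h: "h \<in> {2..N}" "i < j" "j < d h"
      let ?m = "var_mat N d h $$ (i,i) * var_mat N d h $$ (j,j) - (var_mat N d h $$ (i,j))\<^sup>2"
      \<comment> \<open>A form of degree 0 is constant. The common value factors out, so the two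
        evaluations of the minor can compensate each other.\<close>
      have "poly_subst (sep_pt1 d) \<psi> = poly_subst (sep_pt2 d) \<psi>"
        unfolding poly_subst_def monom_subst_def
        by (intro sum.cong refl) (use \<psi> in \<open>auto simp: hom_polys_def in_keys_iff\<close>)
      then have "?L (\<psi>\<^sup>2 * ?m) = (poly_subst (sep_pt2 d) \<psi>)\<^sup>2 * ?L ?m"
        by (simp only: poly_subst_mult poly_subst_power2 distrib_left)
      then show "?L (\<psi>\<^sup>2 * ?m) \<in> {0..}"
        using sep_pt_minor[of d h N i j, OF assms h] by simp
    qed
    then show ?thesis by (simp add: mat_inner_sep_dual[OF c])
  qed
  then show ?thesis by (simp add: DNN_ZVP_def dual_cone_def sep_dual_sym)
qed

text \<open>The form takes the value \<open>- sqrt 2 * sqrt 2 = -2\<close> at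
  \<open>sep_pt1\<close>, and 0 at \<open>sep_pt2\<close>, whose coordinate 0 vanishes.\<close>

lemma mat_inner_sep:
  assumes "N \<ge> 2" "d 1 \<ge> 1" "d 2 \<ge> 2"
  shows "mat_inner (sep_dual N d) (sep_mat N d) < 0"
proof -
  have c: "sep_mat N d \<in> carrier_mat (total_dim N d) (total_dim N d)"
    using sep_mat_sym by (auto simp: sym_mats_def)
  show ?thesis
    unfolding mat_inner_sep_dual[OF c] poly_subst_sep_mat[of N d, OF assms(1,3)]
    using assms(2) by (simp add: sep_pt1_def sep_pt2_def)
qed

theorem theorem4p17:
  fixes N :: nat and d :: "nat \<Rightarrow> nat"
  assumes "N \<ge> 1"
    and "\<And>h. h \<in> {2..N} \<Longrightarrow> d h \<ge> 1"
    and "total_dim N d \<ge> 1"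
  shows "DNN_NN N d \<subseteq> DNN_ZVP N d
    \<and> (N \<ge> 2 \<and> d 1 \<ge> 1 \<and> d 2 \<ge> 2 \<longrightarrow> DNN_NN N d \<subset> DNN_ZVP N d)"
proof (intro conjI impI)
  show sub: "DNN_NN N d \<subseteq> DNN_ZVP N d"
    using K_ZVP0_subset_K_NN0[OF assms(1)] by (auto simp: DNN_NN_def DNN_ZVP_def dual_cone_def)
  assume "N \<ge> 2 \<and> d 1 \<ge> 1 \<and> d 2 \<ge> 2"
  then have *: "N \<ge> 2" "d 1 \<ge> 1" "d 2 \<ge> 2" by auto
  \<comment> \<open>The violated dual inequality is the one for \<open>sep_mat\<close>.\<close>
  have "sep_dual N d \<notin> DNN_NN N d"
    using sep_mat_K_NN0[of N d, OF *] mat_inner_sep[of N d, OF *]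
    by (auto simp: DNN_NN_def dual_cone_def not_le intro!: bexI[of _ "sep_mat N d"])
  then show "DNN_NN N d \<subset> DNN_ZVP N d"
    using sub sep_dual_DNN_ZVP[of d N] * by blast
qed

end
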